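(* Let $F$ be a finite field of characteristic $p$ and order $q$, and let $d$ be a positive integer with $\gcd(d,q-1)=1$ such that $d$ is not degenerate over $F$. Then $V_{F,d}\le\frac23[F:\mathbb{F}_p]$.
   Context: $\psi$ is the canonical additive character of $F$, $\psi(x)=e^{2\pi i\operatorname{Tr}(x)/p}$ with $\operatorname{Tr}$ the absolute trace $F\to\mathbb{F}_p$. For $a\in F$, $W_{F,d}(a)=\sum_{x\in F}\psi(x^d-ax)$, and $V_{F,d}=\min_{a\in F}\operatorname{val}_p(W_{F,d}(a))$, where $\operatorname{val}_p$ is the $p$-adic valuation extended to $\mathbb{Q}(e^{2\pi i/p})$ with $\operatorname{val}_p(1-e^{2\pi i/p})=1/(p-1)$ (so $\operatorname{val}_p(p)=1$). The exponent $d$ is degenerate over $F$ if $d$ is congruent to a power of $p$ modulo $q-1$. *)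

theory Defs
  imports
    Complex_Main
    "HOL-Library.Cardinality"
    "HOL-Library.Extended_Real"
    "HOL-Number_Theory.Cong"
    "HOL-Algebra.Algebraic_Closure_Type"
begin

text \<open>
  The field \<open>F\<close> is a type of class \<open>finite_field\<close>: \<open>p = CHAR('a)\<close> and \<open>q = CARD('a)\<close>.
  The prime field \<open>\<F>\<^sub>p\<close> is the subfield \<open>range of_int\<close> of \<open>F\<close>.
\<close>

definition prime_degree :: "'a::finite_field itself \<Rightarrow> nat" where
  "prime_degree _ =
     ring.dim (ring_of_type_algebra :: 'a ring) (range of_int) (UNIV :: 'a set)"

definition abs_trace :: "'a::finite_field \<Rightarrow> 'a" where
  "abs_trace x = (\<Sum>i<prime_degree TYPE('a). x ^ (CHAR('a) ^ i))"

text \<open>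
  An element of \<open>\<F>\<^sub>p\<close> enters the exponential through its representative in \<open>{0..<p}\<close>.
\<close>

definition canonical_char :: "'a::finite_field \<Rightarrow> complex" where
  "canonical_char x =
     exp (2 * pi * \<i> * of_nat (LEAST k. of_nat k = abs_trace x) / of_nat CHAR('a))"

definition weil_sum :: "nat \<Rightarrow> 'a::finite_field \<Rightarrow> complex" where
  "weil_sum d a = (\<Sum>x\<in>UNIV. canonical_char (x ^ d - a * x))"

definition zeta :: "nat \<Rightarrow> complex" where
  "zeta p = exp (2 * pi * \<i> / of_nat p)"

definition cyclotomic_ints :: "nat \<Rightarrow> complex set" where
  "cyclotomic_ints p = range (\<lambda>f :: int poly. poly (map_poly of_int f) (zeta p))"

text \<open>
  The ring \<open>\<int>[\<zeta>]\<close>, with \<open>\<zeta> = zeta p\<close>, has exactly one prime above \<open>p\<close>, generated by \<open>1 - \<zeta>\<close>,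
  so the \<open>p\<close>-adic valuation has a unique extension to \<open>\<rat>(\<zeta>)\<close>: a nonzero
  \<open>z = (1 - \<zeta>)\<^sup>k u / v\<close> with \<open>u, v \<in> \<int>[\<zeta>]\<close> not divisible by \<open>1 - \<zeta>\<close> has valuation
  \<open>k / (p - 1)\<close>. The value is only meaningful for \<open>p\<close> prime and \<open>z \<in> \<rat>(\<zeta>)\<close>.
\<close>

definition val_p :: "nat \<Rightarrow> complex \<Rightarrow> ereal" where
  "val_p p z =
     (if z = 0 then \<infinity>
      else ereal (of_int (THE k :: int.
        \<exists>u v. {u, v} \<subseteq> cyclotomic_ints p - (\<lambda>w. (1 - zeta p) * w) ` cyclotomic_ints p \<and>
              z = (1 - zeta p) powi k * u / v) / (real p - 1)))"

definition weil_min_val :: "'a::finite_field itself \<Rightarrow> nat \<Rightarrow> ereal" where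
  "weil_min_val _ d = Min (range (\<lambda>a :: 'a. val_p CHAR('a) (weil_sum d a)))"

definition degenerate :: "'a::finite_field itself \<Rightarrow> nat \<Rightarrow> bool" where
  "degenerate _ d \<longleftrightarrow> (\<exists>k. [d = CHAR('a) ^ k] (mod (CARD('a) - 1)))"

end

theory Submission
  imports Defs
begin

text \<open>
  Write \<open>q = |F|\<close>, \<open>n = [F : \<F>\<^sub>p]\<close>. For \<open>(r, s, t) \<noteq> 0\<close>, orthogonality of characters and the
  homogeneity of \<open>x\<^sup>d + y\<^sup>d + z\<^sup>d\<close> give
  \<open>(q - 1) \<Sum>\<^sub>a W(r a) W(s a) W(t a) = q\<^sup>2 (M - q)\<close>, where \<open>M\<close> counts the zeros of
  \<open>x\<^sup>d + y\<^sup>d + z\<^sup>d\<close> on the plane \<open>r x + s y + t z = 0\<close>. If every \<open>W(a)\<close> had valuation above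
  \<open>2n/3\<close>, the left side would have valuation above \<open>2n\<close>, so \<open>p\<close> would divide \<open>M\<close> and hence
  \<open>M \<noteq> 1\<close>: in the projective plane every line would meet the curve \<open>x\<^sup>d + y\<^sup>d + z\<^sup>d = 0\<close>. As \<open>d\<close> is coprime
  to \<open>q - 1\<close>, the curve has \<open>q + 1\<close> points, and a blocking set of that size is a line. So
  \<open>x \<mapsto> x\<^sup>d\<close> is additive, and \<open>d\<close> is degenerate.
\<close>

hide_const (open) Divisibility.prime Polynomials.degree

section \<open>Power maps on finite fields\<close>

lemma finite_field_power_cong:
  fixes x :: "'a::finite_field"
  assumes "[m = n] (mod (CARD('a) - 1))" "x \<noteq> 0"
  shows "x ^ m = x ^ n"
proof -
  have "x ^ CARD('a) = x"
    by (rule finite_field_power_card_eq_same)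
  moreover have "x ^ CARD('a) = x * x ^ (CARD('a) - 1)"
    by (metis finite_UNIV_card_ge_0 finite_class.finite_UNIV power_eq_if less_numeral_extra(3))
  ultimately have one: "x ^ (CARD('a) - 1) = 1"
    using assms(2) by simp
  have "x ^ k = x ^ (k mod (CARD('a) - 1))" for k
  proof -
    have "x ^ k = x ^ ((CARD('a) - 1) * (k div (CARD('a) - 1)) + k mod (CARD('a) - 1))"
      by simp
    also have "\<dots> = x ^ (k mod (CARD('a) - 1))"
      by (simp only: power_add power_mult one power_one mult_1)
    finally show ?thesis .
  qed
  thus ?thesis
    using assms(1) unfolding cong_def by metis
qed

text \<open>An inverse \<open>e\<close> of \<open>d\<close> modulo \<open>q - 1\<close> recovers a
  nonzero \<open>x\<close> from its power: \<open>x = (x ^ d) ^ e\<close>.\<close>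

lemma bij_power_coprime:
  assumes "d > 0" "gcd d (CARD('a::finite_field) - 1) = 1"
  shows "bij (\<lambda>x::'a. x ^ d)"
proof -
  obtain e where e: "[d * e = 1] (mod (CARD('a) - 1))"
    using cong_solve_coprime_nat assms(2) by (auto simp: coprime_iff_gcd_eq_1)
  have "inj (\<lambda>x::'a. x ^ d)"
  proof (rule injI)
    fix x y :: 'a assume eq: "x ^ d = y ^ d"
    show "x = y"
    proof (cases "x = 0 \<or> y = 0")
      case True
      thus ?thesis using eq assms(1) by (auto simp: power_0_left)
    next
      case False
      have "x = (x ^ d) ^ e"
        using finite_field_power_cong[OF e, of x] False by (simp add: power_mult)
      also have "\<dots> = y"
        using finite_field_power_cong[OF e, of y] False eq by (simp add: power_mult)
      finally show ?thesis .
    qed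
  qed
  thus ?thesis
    by (simp add: bij_def finite_UNIV_inj_surj)
qed

text \<open>Treats all characteristics at once: the value \<open>1 = 1 ^ d\<close> forces
  \<open>-1 = 1\<close> by injectivity.\<close>

lemma minus_one_power_of_inj:
  fixes d :: nat
  assumes "inj (\<lambda>x::'a::field. x ^ d)"
  shows "(-1 :: 'a) ^ d = -1"
proof -
  have "((-1 :: 'a) ^ d)\<^sup>2 = 1"
    by (simp flip: power_mult add: mult.commute)
  hence "(-1 :: 'a) ^ d = 1 \<or> (-1 :: 'a) ^ d = -1"
    by (simp add: power2_eq_1_iff)
  thus ?thesis
    using injD[OF assms, of "-1" 1] by auto
qed

text \<open>
  The points of \<open>x\<^sup>d + y\<^sup>d + z\<^sup>d = 0\<close> in the projective plane number \<open>q + 1\<close>, and the hypothesis says that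
  they form a blocking set. If \<open>(u : 1 - u : -1)\<close> were not among them, the \<open>q + 1\<close> lines through it
  would each contain exactly one of them; but the line \<open>x + y + z = 0\<close> contains
  \<open>(1 : 0 : -1)\<close> and \<open>(0 : 1 : -1)\<close>.
\<close>

lemma blocking_imp_power_one_minus:
  fixes d :: nat and u :: "'a::finite_field"
  assumes bij: "bij (\<lambda>x::'a. x ^ d)" and d: "d > 0"
    and blocking: "\<And>r s t :: 'a. (r, s, t) \<noteq> (0, 0, 0) \<Longrightarrow>
      \<exists>x y z. (x, y, z) \<noteq> (0, 0, 0) \<and> r * x + s * y + t * z = 0 \<and> x ^ d + y ^ d + z ^ d = 0"
  shows "u ^ d + (1 - u) ^ d = 1"
proof (rule ccontr)
  assume contra: "u ^ d + (1 - u) ^ d \<noteq> 1"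
  have inj: "x = y" if "x ^ d = y ^ d" for x y :: 'a
    using that bij by (auto dest: bij_is_inj injD)
  have m1: "(-1 :: 'a) ^ d = -1"
    using bij by (intro minus_one_power_of_inj bij_is_inj)
  have neg: "(- x) ^ d = - (x ^ d)" for x :: 'a
    using m1 by (metis mult_minus1 power_mult_distrib)
  define v where "v = 1 - u"
  have u0: "u \<noteq> 0" and v0: "v \<noteq> 0"
    using contra d by (auto simp: v_def power_0_left)
  \<comment> \<open>The coefficients \<open>(1, s, u + s * v)\<close> give the lines through
    \<open>(u : v : -1)\<close>. For \<open>s = 1\<close> this is \<open>x + y + z = 0\<close>, as
    \<open>u + v = 1\<close>; it is the only one among them through \<open>(1 : -1 : 0)\<close>. For
    other \<open>s\<close> the blocking point therefore has \<open>z\<close> nonzero and is scaled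
    to \<open>z = -1\<close>.\<close>
  have ex: "\<exists>x y. x ^ d + y ^ d = 1 \<and> (x - u) + s * (y - v) = 0" if s: "s \<noteq> 1" for s
  proof -
    obtain x y z where xyz: "(x, y, z) \<noteq> (0, 0, 0)" "x + s * y + (u + s * v) * z = 0"
        "x ^ d + y ^ d + z ^ d = 0"
      using blocking[of 1 s "u + s * v"] by auto
    have "z \<noteq> 0"
    proof
      assume z: "z = 0"
      hence "x ^ d = (- y) ^ d"
        using xyz(3) d by (simp add: neg power_0_left eq_neg_iff_add_eq_0)
      hence "x = - y" by (rule inj)
      hence "(s - 1) * y = 0" using xyz(2) z by (simp add: algebra_simps)
      thus False using s xyz(1) z \<open>x = - y\<close> by simp
    qed
    have "(- (x / z)) ^ d + (- (y / z)) ^ d = 1"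
    proof -
      have "(- (x / z)) ^ d + (- (y / z)) ^ d = - ((x ^ d + y ^ d) / z ^ d)"
        unfolding neg by (simp add: power_divide add_divide_distrib)
      also have "x ^ d + y ^ d = - (z ^ d)"
        using xyz(3) by (simp add: eq_neg_iff_add_eq_0)
      finally show ?thesis using \<open>z \<noteq> 0\<close> by simp
    qed
    moreover have "(- (x / z) - u) + s * (- (y / z) - v) = - ((x + s * y + (u + s * v) * z) / z)"
      using \<open>z \<noteq> 0\<close> by (simp add: field_simps)
    ultimately show ?thesis
      using xyz(2) by (metis div_0 minus_zero)
  qed
  then obtain xf yf where XY: "\<And>s. s \<noteq> 1 \<Longrightarrow> xf s ^ d + yf s ^ d = 1"
      "\<And>s. s \<noteq> 1 \<Longrightarrow> (xf s - u) + s * (yf s - v) = 0"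
    by metis
  have Yv: "yf s \<noteq> v" if "s \<noteq> 1" for s
    using XY[OF that] contra by (auto simp: v_def)
  \<comment> \<open>Equal \<open>yf\<close> values give equal \<open>xf\<close> values, hence the
    same point; two different lines through \<open>(u, v)\<close> share only \<open>(u, v)\<close>,
    which is not on the curve.\<close>
  have "inj_on yf (- {1})"
  proof (rule inj_onI)
    fix s s' assume s: "s \<in> - {1}" "s' \<in> - {1}" "yf s = yf s'"
    have "xf s ^ d = xf s' ^ d"
      using XY(1)[of s] XY(1)[of s'] s by (metis ComplD add_right_cancel insertI1)
    hence "xf s = xf s'" by (rule inj)
    moreover have "(s - s') * (yf s - v) =
        ((xf s - u) + s * (yf s - v)) - ((xf s' - u) + s' * (yf s' - v)) - (xf s - xf s')"
      using s(3) by (simp add: algebra_simps)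
    moreover have "(xf s - u) + s * (yf s - v) = 0" "(xf s' - u) + s' * (yf s' - v) = 0"
      using XY(2)[of s] XY(2)[of s'] s by auto
    ultimately have "(s - s') * (yf s - v) = 0"
      by (simp only: diff_self)
    thus "s = s'" using Yv[of s] s by simp
  qed
  \<comment> \<open>The curve points with \<open>y = 0\<close> and \<open>y = 1\<close> are
    \<open>(1, 0)\<close> and \<open>(0, 1)\<close>, and both lie on the excluded line
    \<open>s = 1\<close>. So \<open>q - 1\<close> slopes would inject into \<open>q - 2\<close>
    values.\<close>
  moreover have "yf ` (- {1}) \<subseteq> - {0, 1}"
  proof
    fix y assume "y \<in> yf ` (- {1})"
    then obtain s where s: "s \<noteq> 1" "y = yf s" by auto
    have "y \<noteq> 0"
    proof
      assume "y = 0"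
      hence "xf s ^ d = 1 ^ d" using XY(1)[OF s(1)] s d by (simp add: power_0_left)
      hence "xf s = 1" by (rule inj)
      hence "(1 - s) * v = 0" using XY(2)[OF s(1)] s \<open>y = 0\<close> by (simp add: v_def algebra_simps)
      thus False using s v0 by simp
    qed
    moreover have "y \<noteq> 1"
    proof
      assume "y = 1"
      hence "xf s ^ d = 0 ^ d" using XY(1)[OF s(1)] s d by (simp add: power_0_left)
      hence "xf s = 0" by (rule inj)
      hence "(s - 1) * u = 0" using XY(2)[OF s(1)] s \<open>y = 1\<close> by (simp add: v_def algebra_simps)
      thus False using s u0 by simp
    qed
    ultimately show "y \<in> - {0, 1}" by simp
  qed
  ultimately have "card (- {1 :: 'a}) \<le> card (- {0, 1 :: 'a})"
    by (metis card_inj_on_le finite)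
  moreover have "card (- {0, 1 :: 'a}) < card (- {1 :: 'a})"
  proof (rule psubset_card_mono)
    have "0 \<in> - {1 :: 'a}" "0 \<notin> - {0, 1 :: 'a}" by simp_all
    moreover have "- {0, 1 :: 'a} \<subseteq> - {1}" by blast
    ultimately show "- {0, 1 :: 'a} \<subset> - {1}" by blast
  qed simp
  ultimately show False by simp
qed

text \<open>After reduction of the exponent below \<open>q - 1\<close>, the additivity identity has
  too few possible roots to be anything but an identity of polynomials. Its coefficient at
  \<open>p ^ k\<close>, with \<open>p ^ k\<close> the exact power of \<open>p\<close> in the
  exponent, then shows that the exponent is \<open>p ^ k\<close>.\<close>

lemma power_one_plus_imp_degenerate:
  assumes d: "d > 0" and coprime: "gcd d (CARD('a::finite_field) - 1) = 1"
    and add: "\<And>x :: 'a. (1 + x) ^ d = 1 + x ^ d"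
  shows "degenerate TYPE('a) d"
proof (cases "CARD('a) - 1 = 1")
  case True
  thus ?thesis by (auto simp: degenerate_def)
next
  case False
  define p where "p = CHAR('a)"
  have p: "prime p" by (simp add: p_def)
  have "card {0, 1 :: 'a} \<le> CARD('a)" by (intro card_mono) auto
  hence q2: "CARD('a) > 2" using False by simp
  \<comment> \<open>As \<open>q - 1 > 1\<close> is coprime to \<open>d\<close>, the residue
    \<open>e\<close> is positive, so \<open>x ^ d = x ^ e\<close> holds at \<open>x = 0\<close>
    too.\<close>
  define e where "e = d mod (CARD('a) - 1)"
  have e: "e > 0" "e < CARD('a) - 1"
    using False coprime q2 by (auto simp: e_def intro!: Nat.gr0I)
  have cong: "[d = e] (mod (CARD('a) - 1))"
    by (simp add: e_def cong_def)
  have xe: "x ^ d = x ^ e" for x :: 'a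
    using finite_field_power_cong[OF cong, of x] d e by (cases "x = 0") (simp_all add: power_0_left)
  define f where "f = [:1, 1 :: 'a:] ^ e - 1 - monom 1 e"
  have "degree f \<le> e"
    unfolding f_def
    by (intro degree_diff_le) (auto simp: degree_power_eq degree_monom_eq)
  moreover have "{x. poly f x = 0} = UNIV"
    using add by (auto simp: f_def poly_monom xe)
  ultimately have f0: "f = 0"
    using card_poly_roots_bound[of f] e by fastforce
  obtain k m where km: "e = p ^ k * m" "\<not> p dvd m"
    using multiplicity_decompose'[of e p] e p by (metis neq0_conv not_prime_unit)
  have "[:1, 1 :: 'a:] ^ (p ^ k) = 1 + monom 1 (p ^ k)"
  proof -
    have "[:1, 1 :: 'a:] = 1 + monom 1 1" by (simp add: monom_altdef one_pCons)
    hence "[:1, 1 :: 'a:] ^ (p ^ k) = (1 + monom 1 1) ^ (p ^ k)" by simp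
    also have "\<dots> = 1 + monom 1 1 ^ (p ^ k)"
      by (subst freshmans_dream'[where m = "p ^ k" and n = k]) (auto simp: p_def)
    finally show ?thesis by (simp add: monom_power)
  qed
  hence E: "(1 + monom 1 (p ^ k)) ^ m = 1 + (monom 1 e :: 'a poly)"
    using f0 unfolding f_def km(1) power_mult by (simp add: diff_diff_eq)
  have "m = 1"
  proof (rule ccontr)
    assume "m \<noteq> 1"
    have "m > 0" using e km by (auto intro!: Nat.gr0I)
    have "(1 + monom 1 (p ^ k)) ^ m = (\<Sum>j\<le>m. of_nat (m choose j) * monom (1::'a) (p ^ k) ^ j)"
      by (subst add.commute, subst binomial_ring) simp
    also have "\<dots> = (\<Sum>j\<le>m. monom (of_nat (m choose j)) (p ^ k * j))"
      by (intro sum.cong) (auto simp: monom_power of_nat_poly smult_monom)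
    \<comment> \<open>Only \<open>j = 1\<close> contributes to this coefficient. On the other side
      of \<open>E\<close> the coefficient is zero when \<open>m\<close> is not 1, because then
      \<open>p ^ k\<close> differs from \<open>e\<close>; but \<open>p\<close> does not divide
      \<open>m\<close>.\<close>
    finally have "coeff ((1 + monom (1::'a) (p ^ k)) ^ m) (p ^ k)
        = (\<Sum>j\<le>m. if j = 1 then of_nat (m choose j) else 0)"
      using p by (simp add: coeff_sum prime_gt_0_nat cong: if_cong)
    also have "\<dots> = of_nat m" using \<open>m > 0\<close> by (simp add: Suc_le_eq)
    finally have "coeff (1 + monom (1::'a) e) (p ^ k) = of_nat m" using E by simp
    moreover have "coeff (1 + monom (1::'a) e) (p ^ k) = 0"
      using \<open>m \<noteq> 1\<close> p km(1) \<open>m > 0\<close> by (simp add: prime_gt_0_nat coeff_1)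
    ultimately show False using km(2) by (simp add: of_nat_eq_0_iff_char_dvd p_def)
  qed
  thus ?thesis using cong km by (auto simp: degenerate_def p_def)
qed

section \<open>The prime above \<open>p\<close> in the cyclotomic integers\<close>

abbreviation eval_int_poly :: "int poly \<Rightarrow> 'b::comm_ring_1 \<Rightarrow> 'b" where
  "eval_int_poly f z \<equiv> poly (map_poly of_int f) z"

lemma eval_int_poly_pCons [simp]:
  "eval_int_poly (pCons a f) z = of_int a + z * eval_int_poly f z"
  by (simp add: map_poly_pCons)

lemma eval_int_poly_add [simp]:
  "eval_int_poly (f + g) z = eval_int_poly f z + eval_int_poly g z"
  by (induction f g rule: poly_induct2) (simp_all add: algebra_simps)

lemma eval_int_poly_smult [simp]:
  "eval_int_poly (smult a f) z = of_int a * eval_int_poly f z"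
  by (induction f) (simp_all add: algebra_simps)

lemma eval_int_poly_minus [simp]: "eval_int_poly (- f) z = - eval_int_poly f z"
  using eval_int_poly_smult[of "-1" f z] by simp

lemma eval_int_poly_diff [simp]:
  "eval_int_poly (f - g) z = eval_int_poly f z - eval_int_poly g z"
  using eval_int_poly_add[of f "- g" z] by simp

lemma eval_int_poly_mult [simp]:
  "eval_int_poly (f * g) z = eval_int_poly f z * eval_int_poly g z"
  by (induction f) (simp_all add: algebra_simps)

lemma eval_int_poly_1 [simp]: "eval_int_poly 1 z = 1"
  by (simp add: one_pCons)

lemma eval_int_poly_monom [simp]: "eval_int_poly (monom c n) z = of_int c * z ^ n"
  by (simp add: map_poly_monom poly_monom)

lemma eval_int_poly_sum [simp]: "eval_int_poly (\<Sum>i\<in>A. f i) z = (\<Sum>i\<in>A. eval_int_poly (f i) z)"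
  by (induction A rule: infinite_finite_induct) simp_all

text \<open>Let \<open>g\<close> be the primitive part of a nonzero polynomial of least degree
  vanishing at \<open>z\<close>. Pseudo-division by \<open>g\<close> leaves remainder zero by
  minimality, so \<open>g\<close> divides a multiple \<open>smult a f\<close>; Gauss's lemma removes
  the scalar since \<open>g\<close> is primitive.\<close>

lemma algebraic_primitive_int_poly:
  fixes z :: complex
  assumes "f\<^sub>0 \<noteq> 0" "eval_int_poly f\<^sub>0 z = 0"
  obtains g where "degree g > 0" "eval_int_poly g z = 0"
    "\<And>f. eval_int_poly f z = 0 \<Longrightarrow> g dvd f"
proof -
  define P where "P f \<longleftrightarrow> f \<noteq> 0 \<and> eval_int_poly f z = 0" for f
  define h where "h = arg_min degree P"
  have "P f\<^sub>0" using assms by (simp add: P_def)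
  hence h: "P h" "\<And>f. P f \<Longrightarrow> degree h \<le> degree f"
    using arg_min_nat_lemma[of P f\<^sub>0 degree] by (auto simp: h_def)
  define g where "g = primitive_part h"
  have hg: "h = smult (content h) g"
    by (simp add: g_def)
  have "content h \<noteq> 0" using h(1) by (simp add: P_def)
  have "eval_int_poly h z = of_int (content h) * eval_int_poly g z"
    by (subst hg) (rule eval_int_poly_smult)
  hence g: "P g" "degree g = degree h" "content g = 1"
    using h(1) \<open>content h \<noteq> 0\<close> unfolding P_def by (simp_all add: g_def)
  have dvd: "g dvd f" if "eval_int_poly f z = 0" for f
  proof -
    obtain a q where aq: "a \<noteq> 0" "smult a f = g * q + pseudo_mod f g"
      using pseudo_mod(1)[of g f] g(1) by (auto simp: P_def)
    have "eval_int_poly (smult a f) z = eval_int_poly (g * q + pseudo_mod f g) z"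
      using aq by simp
    hence "eval_int_poly (pseudo_mod f g) z = 0"
      using that g(1) by (simp add: P_def)
    hence "pseudo_mod f g = 0"
      using pseudo_mod(2)[of g f] h(2)[of "pseudo_mod f g"] g unfolding P_def by linarith
    hence "g dvd smult a f" using aq by simp
    hence "fract_poly g dvd smult (to_fract a) (fract_poly f)"
      using fract_poly_dvd[of g "smult a f"] by simp
    hence "fract_poly g dvd fract_poly f"
      using aq(1) by (meson dvd_smult_cancel to_fract_eq_0_iff)
    thus ?thesis using g(3) by (rule fract_poly_dvdD)
  qed
  have "degree g > 0"
  proof (rule Nat.gr0I)
    assume "degree g = 0"
    then obtain c where "g = [:c:]" by (rule degree_eq_zeroE)
    thus False using g(1) by (simp add: P_def)
  qed
  thus ?thesis using that dvd g(1) by (auto simp: P_def)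
qed

text \<open>
  As in Eisenstein's criterion, substitute \<open>X + 1\<close> for \<open>X\<close>: modulo \<open>p\<close> the product \<open>g h\<close> becomes \<open>X\<^sup>p\<close>, so
  if \<open>p\<close> did not divide \<open>g(1)\<close>, then \<open>h\<close>, whose degree is below \<open>p\<close>, would vanish modulo \<open>p\<close>.
\<close>

lemma dvd_poly_1_of_dvd_X_power_minus_1:
  fixes g :: "int poly"
  assumes p: "prime p" and "g dvd monom 1 p - 1" "degree g > 0"
  shows "int p dvd poly g 1"
proof (rule ccontr)
  assume ndvd: "\<not> int p dvd poly g 1"
  obtain h where h: "monom 1 p - 1 = g * h" using assms(2) by (auto elim: dvdE)
  define G H where "G = pcompose g [:1, 1:]" and "H = pcompose h [:1, 1:]"
  have p0: "p > 0" using p by (simp add: prime_gt_0_nat)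
  have "G * H = pcompose (monom 1 p - 1) [:1, 1:]"
    by (simp add: G_def H_def h pcompose_mult)
  also have "\<dots> = [:1, 1:] ^ p - 1"
  proof -
    have "pcompose (monom 1 n) r = r ^ n" for r :: "int poly" and n
      by (induction n) (simp_all add: monom_Suc pcompose_pCons one_pCons monom_0)
    thus ?thesis by (simp add: pcompose_diff pcompose_1)
  qed
  finally have GH: "G * H = [:1, 1:] ^ p - 1" .
  have deg: "degree H = degree h"
    by (simp add: H_def degree_pcompose)
  have "coeff (monom 1 p - 1 :: int poly) p = 1"
    using p0 by simp
  hence "monom 1 p - 1 \<noteq> (0 :: int poly)"
    by (metis coeff_0 zero_neq_one)
  hence "h \<noteq> 0" "g \<noteq> 0" using h by auto
  moreover have "degree (monom 1 p - 1 :: int poly) \<le> p"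
    by (intro degree_diff_le) (auto simp: degree_monom_le)
  ultimately have hp: "degree h < p"
    using h assms(3) by (simp add: degree_mult_eq)
  have G0: "coeff G 0 = poly g 1"
    by (simp add: G_def coeff_pcompose_0)
  \<comment> \<open>Below degree \<open>p\<close> every coefficient of \<open>G * H\<close> is
    divisible by \<open>p\<close>. By induction so are all terms of the convolution except
    \<open>coeff G 0 * coeff H i\<close>, and \<open>p\<close> does not divide
    \<open>coeff G 0\<close>.\<close>
  have "int p dvd coeff H i" if "i < p" for i
    using that
  proof (induction i rule: less_induct)
    case (less i)
    have "int p dvd coeff (G * H) i"
    proof (cases "i = 0")
      case False
      have "int p dvd int (p choose i)"
        using dvd_choose_prime[of i p] False less.prems p by simp
      thus ?thesis
        using False less.prems by (simp add: GH coeff_linear_poly_power coeff_1)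
    qed (simp add: GH coeff_linear_poly_power)
    also have "coeff (G * H) i = coeff G 0 * coeff H i + (\<Sum>j=1..i. coeff G j * coeff H (i - j))"
      by (simp add: coeff_mult atMost_atLeast0 sum.atLeast_Suc_atMost)
    finally have "int p dvd coeff G 0 * coeff H i"
      using less by (subst (asm) dvd_add_left_iff) (auto intro!: dvd_sum dvd_mult)
    thus ?case using ndvd p by (simp add: G0 prime_dvd_mult_iff)
  qed
  hence "\<forall>i. int p dvd coeff H i"
    using hp deg by (metis coeff_eq_0 dvd_0_right linorder_not_less order.strict_trans1)
  then have "[:int p:] dvd H" by (simp add: const_poly_dvd_iff)
  hence "[:int p:] dvd [:1, 1:] ^ p - 1" using GH by (metis dvd_mult)
  hence "int p dvd coeff ([:1, 1:] ^ p - 1) p" by (simp add: const_poly_dvd_iff)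
  thus False using p0 p by (simp add: coeff_linear_poly_power coeff_1)
qed


section \<open>The cyclotomic integers and the ideal generated by \<open>1 - zeta p\<close>\<close>

lemma zeta_eq_cis: "zeta p = cis (2 * pi / real p)"
  by (simp add: zeta_def cis_conv_exp mult_ac)

lemma zeta_power_self:
  assumes "p > 0"
  shows "zeta p ^ p = 1"
  using assms by (simp add: zeta_eq_cis DeMoivre)

lemma zeta_neq_1:
  assumes "p > 1"
  shows "zeta p \<noteq> 1"
proof
  assume "zeta p = 1"
  hence "cis (2 * pi * real 1 / real p) = cis (2 * pi * real 0 / real p)"
    by (simp add: zeta_eq_cis)
  moreover have "inj_on (\<lambda>k. cis (2 * pi * real k / real p)) {..<p}"
    using Complex.bij_betw_roots_unity[of p] assms by (simp add: bij_betw_def)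
  ultimately show False
    using inj_onD[of "\<lambda>k. cis (2 * pi * real k / real p)" "{..<p}" 1 0] assms by simp
qed

lemma cyclotomic_ints_iff: "z \<in> cyclotomic_ints p \<longleftrightarrow> (\<exists>f. z = eval_int_poly f (zeta p))"
  by (auto simp: cyclotomic_ints_def)

lemma cyclotomic_ints_eval [simp]: "eval_int_poly f (zeta p) \<in> cyclotomic_ints p"
  by (auto simp: cyclotomic_ints_iff)

lemma cyclotomic_ints_add [simp]:
  "x \<in> cyclotomic_ints p \<Longrightarrow> y \<in> cyclotomic_ints p \<Longrightarrow> x + y \<in> cyclotomic_ints p"
  unfolding cyclotomic_ints_iff by (metis eval_int_poly_add)

lemma cyclotomic_ints_diff [simp]:
  "x \<in> cyclotomic_ints p \<Longrightarrow> y \<in> cyclotomic_ints p \<Longrightarrow> x - y \<in> cyclotomic_ints p"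
  unfolding cyclotomic_ints_iff by (metis eval_int_poly_diff)

lemma cyclotomic_ints_mult [simp]:
  "x \<in> cyclotomic_ints p \<Longrightarrow> y \<in> cyclotomic_ints p \<Longrightarrow> x * y \<in> cyclotomic_ints p"
  unfolding cyclotomic_ints_iff by (metis eval_int_poly_mult)

lemma cyclotomic_ints_of_int [simp]: "of_int k \<in> cyclotomic_ints p"
  using cyclotomic_ints_eval[of "[:k:]" p] by simp

lemma cyclotomic_ints_of_nat [simp]: "of_nat k \<in> cyclotomic_ints p"
  using cyclotomic_ints_of_int[of "int k" p] by simp

lemma cyclotomic_ints_0 [simp]: "0 \<in> cyclotomic_ints p"
  using cyclotomic_ints_of_int[of 0 p] by simp

lemma cyclotomic_ints_1 [simp]: "1 \<in> cyclotomic_ints p"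
  using cyclotomic_ints_of_int[of 1 p] by simp

lemma cyclotomic_ints_zeta [simp]: "zeta p \<in> cyclotomic_ints p"
  using cyclotomic_ints_eval[of "[:0, 1:]" p] by simp

lemma cyclotomic_ints_power [simp]: "x \<in> cyclotomic_ints p \<Longrightarrow> x ^ n \<in> cyclotomic_ints p"
  by (induction n) simp_all

lemma cyclotomic_ints_sum [simp]:
  "(\<And>i. i \<in> A \<Longrightarrow> f i \<in> cyclotomic_ints p) \<Longrightarrow> (\<Sum>i\<in>A. f i) \<in> cyclotomic_ints p"
  by (induction A rule: infinite_finite_induct) simp_all

lemma zeta_minimal_poly:
  assumes "p > 0"
  obtains g where "degree g > 0" "eval_int_poly g (zeta p) = 0"
    "\<And>f. eval_int_poly f (zeta p) = 0 \<Longrightarrow> g dvd f" "g dvd monom 1 p - 1"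
proof -
  have root: "eval_int_poly (monom 1 p - 1) (zeta p) = 0"
    using zeta_power_self[OF assms] by simp
  have "coeff (monom 1 p - 1 :: int poly) p = 1"
    using assms by simp
  hence "monom 1 p - 1 \<noteq> (0 :: int poly)"
    by (metis coeff_0 zero_neq_one)
  from algebraic_primitive_int_poly[OF this root] show ?thesis
    using root that by metis
qed

text \<open>Makes the map from \<open>f(zeta)\<close> to \<open>f(1)\<close> modulo \<open>p\<close>
  well defined on the cyclotomic integers.\<close>

lemma zeta_root_imp_dvd_poly_1:
  assumes "prime p" "eval_int_poly f (zeta p) = 0"
  shows "int p dvd poly f 1"
proof -
  obtain g where g: "degree g > 0" "g dvd f" "g dvd monom 1 p - 1"
    using zeta_minimal_poly[of p] assms by (metis prime_gt_0_nat)
  have "poly g 1 dvd poly f 1"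
    using g(2) by (auto elim!: dvdE)
  thus ?thesis
    using dvd_poly_1_of_dvd_X_power_minus_1[OF assms(1) g(3,1)] by (rule dvd_trans[rotated])
qed

abbreviation lambda_multiples :: "nat \<Rightarrow> complex set" where
  "lambda_multiples p \<equiv> (\<lambda>w. (1 - zeta p) * w) ` cyclotomic_ints p"

text \<open>Division by \<open>X - 1\<close> with remainder: \<open>f(1)\<close> is the residue of
  \<open>f(z)\<close> modulo \<open>1 - z\<close>.\<close>

lemma eval_int_poly_synthetic_div:
  "eval_int_poly f z = of_int (poly f 1) - (1 - z) * eval_int_poly (synthetic_div f 1) z"
proof -
  have "eval_int_poly ([:-1, 1:] * synthetic_div f 1 + [:poly f 1:]) z = eval_int_poly f z"
    using synthetic_div_correct'[of 1 f] by simp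
  thus ?thesis
    by (simp add: algebra_simps)
qed

lemma sum_zeta_powers:
  assumes "prime p"
  shows "(\<Sum>i<p. zeta p ^ i) = 0"
proof -
  have "(1 - zeta p) * (\<Sum>i<p. zeta p ^ i) = 1 - zeta p ^ p"
    by (rule one_diff_power_eq[symmetric])
  thus ?thesis
    using zeta_power_self[of p] zeta_neq_1[of p] prime_gt_1_nat[OF assms] by simp
qed

text \<open>The residue ring modulo \<open>1 - zeta p\<close> is the field of \<open>p\<close>
  elements, through evaluation at 1. For the converse, \<open>1 + X + ... + X^(p-1)\<close> vanishes
  at \<open>zeta p\<close> and equals \<open>p\<close> at 1, so \<open>p\<close> is a multiple of
  \<open>1 - zeta p\<close>.\<close>

lemma eval_in_lambda_multiples_iff:
  assumes "prime p"
  shows "eval_int_poly f (zeta p) \<in> lambda_multiples p \<longleftrightarrow> int p dvd poly f 1"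
proof
  assume "eval_int_poly f (zeta p) \<in> lambda_multiples p"
  then obtain h where "eval_int_poly f (zeta p) = (1 - zeta p) * eval_int_poly h (zeta p)"
    by (metis (no_types, lifting) cyclotomic_ints_iff imageE)
  hence "eval_int_poly (f - [:1, -1:] * h) (zeta p) = 0"
    by (simp add: algebra_simps)
  from zeta_root_imp_dvd_poly_1[OF assms this] show "int p dvd poly f 1"
    by simp
next
  assume "int p dvd poly f 1"
  then obtain m where m: "poly f 1 = int p * m" by (auto elim: dvdE)
  define h :: "int poly" where "h = (\<Sum>i<p. monom 1 i)"
  have "eval_int_poly h (zeta p) = 0"
    using sum_zeta_powers[OF assms] by (simp add: h_def)
  moreover have "poly h 1 = int p"
    by (simp add: h_def poly_sum poly_monom)
  ultimately have "of_nat p = (1 - zeta p) * eval_int_poly (synthetic_div h 1) (zeta p)"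
    using eval_int_poly_synthetic_div[of h "zeta p"] by simp
  moreover have "eval_int_poly f (zeta p) =
      of_nat p * of_int m - (1 - zeta p) * eval_int_poly (synthetic_div f 1) (zeta p)"
    using eval_int_poly_synthetic_div[of f "zeta p"] by (simp add: m)
  ultimately have "eval_int_poly f (zeta p) = (1 - zeta p) *
      (eval_int_poly (synthetic_div h 1) (zeta p) * of_int m - eval_int_poly (synthetic_div f 1) (zeta p))"
    by (simp add: right_diff_distrib mult.assoc)
  thus "eval_int_poly f (zeta p) \<in> lambda_multiples p"
    by (rule image_eqI) simp
qed

lemma of_int_in_lambda_multiples_iff:
  assumes "prime p"
  shows "of_int m \<in> lambda_multiples p \<longleftrightarrow> int p dvd m"
  using eval_in_lambda_multiples_iff[OF assms, of "[:m:]"] by simp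

text \<open>\<open>1 - zeta p\<close> is a prime element: by evaluation at 1 this reduces to the
  primality of \<open>p\<close> in the integers.\<close>

lemma lambda_multiples_mult_iff:
  assumes "prime p" "u \<in> cyclotomic_ints p" "v \<in> cyclotomic_ints p"
  shows "u * v \<in> lambda_multiples p \<longleftrightarrow> u \<in> lambda_multiples p \<or> v \<in> lambda_multiples p"
proof -
  obtain f g where "u = eval_int_poly f (zeta p)" "v = eval_int_poly g (zeta p)"
    using assms by (auto simp: cyclotomic_ints_iff)
  thus ?thesis
    using eval_in_lambda_multiples_iff[OF assms(1), of "f * g"] assms(1)
    by (simp add: eval_in_lambda_multiples_iff prime_dvd_mult_iff)
qed

text \<open>Since \<open>(p - 1) choose i\<close> is congruent to \<open>(-1) ^ i\<close> modulo
  \<open>p\<close>, the power is congruent to the sum of all \<open>zeta p ^ i\<close>, which is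
  zero.\<close>

lemma lambda_power_eq_p_mult:
  assumes p: "prime p"
  obtains e where "e \<in> cyclotomic_ints p" "(1 - zeta p) ^ (p - 1) = of_nat p * e"
proof -
  have p0: "p > 0" using p by (simp add: prime_gt_0_nat)
  have dvd: "int p dvd (-1) ^ i * int ((p - 1) choose i) - 1" if "i < p" for i
    using that
  proof (induction i)
    case (Suc i)
    have "p choose Suc i = ((p - 1) choose i) + ((p - 1) choose Suc i)"
      using p0 by (metis Suc_pred' binomial_Suc_Suc)
    hence "(-1) ^ Suc i * int ((p - 1) choose Suc i) - 1 =
        ((-1) ^ i * int ((p - 1) choose i) - 1) + (-1) ^ Suc i * int (p choose Suc i)"
      by (simp add: algebra_simps)
    moreover have "int p dvd int (p choose Suc i)"
      using dvd_choose_prime[of "Suc i" p] Suc.prems p by simp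
    ultimately show ?case
      using Suc by (metis Suc_lessD dvd_add dvd_mult)
  qed simp
  then obtain c where c: "\<And>i. i < p \<Longrightarrow> (-1) ^ i * int ((p - 1) choose i) - 1 = int p * c i"
    unfolding dvd_def by metis
  have "(1 - zeta p) ^ (p - 1) = (\<Sum>i\<le>p - 1. of_nat ((p - 1) choose i) * (- zeta p) ^ i)"
    using binomial_ring[of "- zeta p" 1 "p - 1"] by simp
  also have "{..p - 1} = {..<p}"
    using p0 by auto
  also have "(\<Sum>i<p. of_nat ((p - 1) choose i) * (- zeta p) ^ i) =
      (\<Sum>i<p. of_int ((-1) ^ i * int ((p - 1) choose i)) * zeta p ^ i)"
    by (intro sum.cong refl, subst power_minus) simp
  also have "\<dots> = (\<Sum>i<p. of_int ((-1) ^ i * int ((p - 1) choose i)) * zeta p ^ i) - (\<Sum>i<p. zeta p ^ i)"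
    using sum_zeta_powers[OF p] by simp
  also have "\<dots> = (\<Sum>i<p. of_int ((-1) ^ i * int ((p - 1) choose i) - 1) * zeta p ^ i)"
    by (simp add: sum_subtractf algebra_simps)
  also have "\<dots> = (\<Sum>i<p. of_int (int p * c i) * zeta p ^ i)"
    by (intro sum.cong refl) (simp only: c lessThan_iff)
  also have "\<dots> = of_nat p * (\<Sum>i<p. of_int (c i) * zeta p ^ i)"
    by (simp add: sum_distrib_left mult_ac)
  finally show ?thesis
    by (rule that[rotated]) simp
qed

text \<open>Each block of \<open>p - 1\<close> factors \<open>1 - zeta p\<close> yields one factor
  \<open>p\<close>. After cancellation of \<open>p ^ s\<close> a factor \<open>1 - zeta p\<close> of
  \<open>m\<close> is left over.\<close>

lemma lambda_power_dvd_imp_dvd: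
  assumes p: "prime p" and w: "w \<in> cyclotomic_ints p"
    and eq: "of_nat p ^ s * of_int m = (1 - zeta p) ^ (s * (p - 1) + 1) * w"
  shows "int p dvd m"
proof -
  obtain e where e: "e \<in> cyclotomic_ints p" "(1 - zeta p) ^ (p - 1) = of_nat p * e"
    using lambda_power_eq_p_mult[OF p] by blast
  have "(1 - zeta p) ^ (s * (p - 1) + 1) = ((1 - zeta p) ^ (p - 1)) ^ s * (1 - zeta p)"
    by (simp add: power_add mult.commute flip: power_mult)
  also have "\<dots> = of_nat p ^ s * e ^ s * (1 - zeta p)"
    by (simp only: e(2) power_mult_distrib)
  finally have "of_nat p ^ s * of_int m = of_nat p ^ s * ((1 - zeta p) * (e ^ s * w))"
    using eq by (simp add: mult_ac)
  hence "of_int m = (1 - zeta p) * (e ^ s * w)"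
    using p by (simp add: prime_gt_0_nat)
  hence "of_int m \<in> lambda_multiples p"
    using e(1) w by auto
  thus ?thesis
    using of_int_in_lambda_multiples_iff[OF p] by simp
qed

text \<open>Takes the place of the norm. Among the polynomials whose value at \<open>zeta p\<close>
  is a nonzero multiple of \<open>z\<close>, one of least degree turns out to be constant.\<close>

lemma cyclotomic_int_dvd_int:
  assumes "p > 0" "z \<in> cyclotomic_ints p" "z \<noteq> 0"
  obtains N w where "N \<noteq> 0" "w \<in> cyclotomic_ints p" "of_int N = z * w"
proof -
  obtain g where g: "degree g > 0" "eval_int_poly g (zeta p) = 0"
      "\<And>f. eval_int_poly f (zeta p) = 0 \<Longrightarrow> g dvd f"
    using zeta_minimal_poly[OF assms(1)] by metis
  have g0: "g \<noteq> 0" using g(1) by auto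
  define P where "P f \<longleftrightarrow> eval_int_poly f (zeta p) \<noteq> 0 \<and>
    (\<exists>w\<in>cyclotomic_ints p. eval_int_poly f (zeta p) = z * w)" for f
  define h where "h = arg_min degree P"
  obtain f\<^sub>0 where "z = eval_int_poly f\<^sub>0 (zeta p)"
    using assms(2) by (auto simp: cyclotomic_ints_iff)
  hence "P f\<^sub>0"
    using assms(3) by (auto simp: P_def intro!: bexI[of _ 1])
  hence h: "P h" "\<And>f. P f \<Longrightarrow> degree h \<le> degree f"
    using arg_min_nat_lemma[of P f\<^sub>0 degree] by (auto simp: h_def)
  obtain w where w: "w \<in> cyclotomic_ints p" "eval_int_poly h (zeta p) = z * w"
    using h(1) by (auto simp: P_def)
  have hz: "eval_int_poly h (zeta p) \<noteq> 0"
    using h(1) by (simp add: P_def)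
  hence h0: "h \<noteq> 0" by auto
  \<comment> \<open>The pseudo-remainder of \<open>h\<close> modulo \<open>g\<close> also satisfies
    \<open>P\<close>.\<close>
  have "degree h < degree g"
  proof -
    obtain a q where a: "a \<noteq> 0" "smult a h = g * q + pseudo_mod h g"
      using pseudo_mod(1)[OF g0, of h] by blast
    have "eval_int_poly (pseudo_mod h g) (zeta p) = of_int a * eval_int_poly h (zeta p)"
      using arg_cong[OF a(2), of "\<lambda>f. eval_int_poly f (zeta p)"] g(2) by simp
    hence r: "P (pseudo_mod h g)"
      using a(1) hz w by (auto simp: P_def intro!: bexI[of _ "of_int a * w"])
    hence "pseudo_mod h g \<noteq> 0" by (auto simp: P_def)
    thus ?thesis using pseudo_mod(2)[OF g0, of h] h(2)[OF r] by simp
  qed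
  obtain b q where b: "b \<noteq> 0" "smult b g = h * q + pseudo_mod g h"
    using pseudo_mod(1)[OF h0, of g] by blast
  have r: "eval_int_poly (pseudo_mod g h) (zeta p) = eval_int_poly h (zeta p) * (- eval_int_poly q (zeta p))"
    using arg_cong[OF b(2), of "\<lambda>f. eval_int_poly f (zeta p)"] g(2)
    by (simp add: eq_neg_iff_add_eq_0 add.commute)
  \<comment> \<open>Otherwise the pseudo-remainder of \<open>g\<close> modulo \<open>h\<close> would
    satisfy \<open>P\<close> in smaller degree than \<open>h\<close>.\<close>
  have "eval_int_poly q (zeta p) = 0"
  proof (rule ccontr)
    assume q: "eval_int_poly q (zeta p) \<noteq> 0"
    hence nz: "eval_int_poly (pseudo_mod g h) (zeta p) \<noteq> 0"
      using r hz by simp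
    moreover have "eval_int_poly (pseudo_mod g h) (zeta p) = z * (w * eval_int_poly (- q) (zeta p))"
      using r w(2) by simp
    ultimately have "P (pseudo_mod g h)"
      unfolding P_def using w(1) by (blast intro: cyclotomic_ints_mult cyclotomic_ints_eval)
    moreover have "pseudo_mod g h \<noteq> 0" using nz by auto
    ultimately show False
      using pseudo_mod(2)[OF h0, of g] h(2) by fastforce
  qed
  \<comment> \<open>The remainder is divisible by \<open>g\<close> but of smaller degree, hence
    zero; in \<open>smult b g = h * q\<close> the factor \<open>q\<close> then takes up the whole
    degree.\<close>
  hence "g dvd q" "g dvd pseudo_mod g h"
    using r g(3) by auto
  moreover from this(2) have "pseudo_mod g h = 0"
    using pseudo_mod(2)[OF h0, of g] \<open>degree h < degree g\<close> dvd_imp_degree_le[of g "pseudo_mod g h"]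
    by linarith
  ultimately have "smult b g = h * q" "q \<noteq> 0" "degree g \<le> degree q"
    using b g0 by (auto dest: dvd_imp_degree_le)
  hence "degree h = 0"
    using h0 b(1) degree_mult_eq[of h q] degree_smult_eq[of b g] by simp
  then obtain N where N: "h = [:N:]" by (rule degree_eq_zeroE)
  hence "N \<noteq> 0"
    using h0 by simp
  from that[OF this w(1)] show ?thesis
    using w(2) N by simp
qed

text \<open>\<open>z\<close> divides a nonzero integer \<open>N\<close>, so the exponent of
  \<open>1 - zeta p\<close> in \<open>z\<close> is at most \<open>p - 1\<close> times the
  multiplicity of \<open>p\<close> in \<open>N\<close>. The cofactor of the largest power is not
  divisible by \<open>1 - zeta p\<close>.\<close>

lemma lambda_factorization:
  assumes p: "prime p" and z: "z \<in> cyclotomic_ints p" "z \<noteq> 0"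
  obtains k u where "u \<in> cyclotomic_ints p - lambda_multiples p" "z = (1 - zeta p) ^ k * u"
proof -
  define P where "P k \<longleftrightarrow> (\<exists>w\<in>cyclotomic_ints p. z = (1 - zeta p) ^ k * w)" for k
  obtain N w where N: "N \<noteq> 0" "w \<in> cyclotomic_ints p" "of_int N = z * w"
    using cyclotomic_int_dvd_int[OF _ z] p by (metis prime_gt_0_nat)
  obtain m where m: "N = int p ^ multiplicity (int p) N * m" "\<not> int p dvd m"
    using multiplicity_decompose'[of N "int p"] N(1) p
    by (metis not_prime_unit prime_nat_int_transfer)
  define s where "s = multiplicity (int p) N"
  have bound: "k \<le> s * (p - 1)" if "P k" for k
  proof (rule ccontr)
    assume k: "\<not> k \<le> s * (p - 1)"
    obtain v where v: "v \<in> cyclotomic_ints p" "z = (1 - zeta p) ^ k * v"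
      using \<open>P k\<close> by (auto simp: P_def)
    have "of_nat p ^ s * of_int m = (of_int N :: complex)"
      by (subst m(1)) (simp add: s_def)
    also have "\<dots> = (1 - zeta p) ^ (s * (p - 1) + 1 + (k - (s * (p - 1) + 1))) * v * w"
      using k N(3) v(2) by simp
    also have "\<dots> = (1 - zeta p) ^ (s * (p - 1) + 1) * ((1 - zeta p) ^ (k - (s * (p - 1) + 1)) * v * w)"
      by (subst power_add) (simp add: mult_ac)
    finally have "int p dvd m"
      by (rule lambda_power_dvd_imp_dvd[OF p, rotated]) (simp add: v N)
    thus False using m(2) by simp
  qed
  have "P 0" using z by (auto simp: P_def)
  define k where "k = (GREATEST k. P k)"
  have "P k" unfolding k_def
    using \<open>P 0\<close> bound by (rule GreatestI_nat)
  moreover have "\<not> P (Suc k)"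
    using Greatest_le_nat[of P "Suc k" "s * (p - 1)"] bound by (auto simp: k_def)
  ultimately obtain u where "u \<in> cyclotomic_ints p" "z = (1 - zeta p) ^ k * u"
      "u \<notin> lambda_multiples p"
    unfolding P_def by (metis (no_types, lifting) imageE mult.assoc power_Suc2)
  thus ?thesis using that by blast
qed

text \<open>The point is uniqueness of the exponent under \<open>THE\<close>: cross-multiplying two
  representations with different exponents would make a product of two non-multiples of the prime
  \<open>1 - zeta p\<close> a multiple.\<close>

lemma val_p_eq:
  assumes p: "prime p" and u: "u \<in> cyclotomic_ints p - lambda_multiples p"
  shows "val_p p ((1 - zeta p) ^ k * u) = ereal (real k / (real p - 1))"
proof -
  let ?U = "cyclotomic_ints p - lambda_multiples p"
  define l where "l = 1 - zeta p"
  have l0: "l \<noteq> 0"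
    using zeta_neq_1[of p] prime_gt_1_nat[OF p] by (simp add: l_def)
  have one: "1 \<in> ?U"
    using of_int_in_lambda_multiples_iff[OF p, of 1] p by auto
  have U0: "x \<noteq> 0" if "x \<in> ?U" for x
    using that of_int_in_lambda_multiples_iff[OF p, of 0] by auto
  have le: "i \<le> j" if "u \<in> ?U" "v \<in> ?U" "u' \<in> ?U" "v' \<in> ?U"
    "l powi i * u / v = l powi j * u' / v'" for i j :: int and u v u' v'
  proof (rule ccontr)
    assume "\<not> i \<le> j"
    define n where "n = nat (i - j)"
    have n: "i = j + int n" "n > 0"
      using \<open>\<not> i \<le> j\<close> by (auto simp: n_def)
    have "l powi i = l powi j * l ^ n"
      unfolding n(1) using l0 by (simp add: power_int_add)
    hence "l ^ n * u * v' = u' * v"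
      using that(5) U0 l0 \<open>v \<in> ?U\<close> \<open>v' \<in> ?U\<close> by (simp add: field_simps)
    moreover have "l ^ n = l * l ^ (n - 1)"
      using n(2) by (simp add: power_eq_if)
    ultimately have "u' * v = l * (l ^ (n - 1) * u * v')"
      by (simp add: mult.assoc)
    moreover have "l ^ (n - 1) * u * v' \<in> cyclotomic_ints p"
      using that by (simp add: l_def)
    ultimately have "u' * v \<in> lambda_multiples p"
      by (auto simp: l_def)
    thus False
      using that lambda_multiples_mult_iff[OF p, of u' v] by simp
  qed
  have "(THE j :: int. \<exists>u' v. {u', v} \<subseteq> ?U \<and> l ^ k * u = l powi j * u' / v) = int k"
  proof (rule the_equality)
    show "\<exists>u' v. {u', v} \<subseteq> ?U \<and> l ^ k * u = l powi int k * u' / v"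
      by (rule exI[of _ u], rule exI[of _ 1]) (use u one in simp)
  next
    fix j :: int
    assume "\<exists>u' v. {u', v} \<subseteq> ?U \<and> l ^ k * u = l powi j * u' / v"
    then obtain u' v where uv: "u' \<in> ?U" "v \<in> ?U" "l powi int k * u / 1 = l powi j * u' / v"
      by auto
    show "j = int k"
      using le[OF u one uv] le[OF uv(1,2) u one uv(3)[symmetric]] by simp
  qed
  moreover have "l ^ k * u \<noteq> 0"
    using l0 U0[OF u] by simp
  ultimately show ?thesis
    unfolding val_p_def l_def by simp
qed

text \<open>Turns a strict valuation bound into divisibility. The last hypothesis says that
  \<open>k\<close> is at most every natural number above \<open>c * (p - 1)\<close>;
  \<open>z = 0\<close>, of infinite valuation, is trivial.\<close>

lemma less_val_p_imp_lambda_power_dvd: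
  assumes p: "prime p" and z: "z \<in> cyclotomic_ints p" and c: "ereal c < val_p p z"
    and k: "\<And>m. c * (real p - 1) < real m \<Longrightarrow> k \<le> m"
  shows "\<exists>w\<in>cyclotomic_ints p. z = (1 - zeta p) ^ k * w"
proof (cases "z = 0")
  case True
  thus ?thesis by (auto intro!: bexI[of _ 0])
next
  case False
  obtain m u where u: "u \<in> cyclotomic_ints p - lambda_multiples p" "z = (1 - zeta p) ^ m * u"
    using lambda_factorization[OF p z False] by metis
  have "c < real m / (real p - 1)"
    using c val_p_eq[OF p u(1), of m] u(2) by simp
  moreover have "real p - 1 > 0"
    using prime_gt_1_nat[OF p] by simp
  ultimately have "c * (real p - 1) < real m"
    by (simp add: field_simps)
  hence "k \<le> m" by (rule k)
  hence "z = (1 - zeta p) ^ k * ((1 - zeta p) ^ (m - k) * u)"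
    by (simp add: u(2) flip: mult.assoc power_add)
  thus ?thesis
    using u(1) by (blast intro: cyclotomic_ints_mult cyclotomic_ints_power cyclotomic_ints_diff
        cyclotomic_ints_1 cyclotomic_ints_zeta)
qed

section \<open>The canonical additive character\<close>

lemma bij_betw_of_nat_prime_field:
  "bij_betw of_nat {..<CHAR('a::finite_field)} (range (of_int :: int \<Rightarrow> 'a))"
proof (rule bij_betw_imageI)
  show "inj_on (of_nat :: nat \<Rightarrow> 'a) {..<CHAR('a)}"
    by (rule inj_onI) (simp add: of_nat_eq_iff_cong_CHAR cong_def)
  have "of_int i \<in> (of_nat :: nat \<Rightarrow> 'a) ` {..<CHAR('a)}" for i :: int
  proof
    have "of_int i = (of_int (int CHAR('a) * (i div int CHAR('a)) + i mod int CHAR('a)) :: 'a)"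
      by simp
    also have "\<dots> = of_int (i mod int CHAR('a))"
      by (simp only: of_int_add of_int_mult of_int_of_nat_eq of_nat_CHAR) simp
    also have "i mod int CHAR('a) = int (nat (i mod int CHAR('a)))"
      by simp
    finally show "of_int i = (of_nat (nat (i mod int CHAR('a))) :: 'a)"
      by simp
    show "nat (i mod int CHAR('a)) \<in> {..<CHAR('a)}"
      by (simp add: nat_less_iff)
  qed
  thus "(of_nat :: nat \<Rightarrow> 'a) ` {..<CHAR('a)} = range of_int"
    by (auto intro: range_eqI[of _ _ "int _"])
qed

lemma card_prime_field: "card (range (of_int :: int \<Rightarrow> 'a::finite_field)) = CHAR('a)"
  using bij_betw_same_card[OF bij_betw_of_nat_prime_field[where ?'a = 'a]] by simp

lemma subfield_prime_field:
  "subfield (range of_int) (ring_of_type_algebra :: 'a::finite_field ring)"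
proof -
  let ?R = "ring_of_type_algebra :: 'a ring"
  interpret R: field ?R by rule
  have add: "x \<oplus>\<^bsub>?R\<^esub> y = x + y" and mult: "x \<otimes>\<^bsub>?R\<^esub> y = x * y"
    and one: "\<one>\<^bsub>?R\<^esub> = 1" and zero: "\<zero>\<^bsub>?R\<^esub> = 0" and carrier: "carrier ?R = UNIV" for x y :: 'a
    by (simp_all add: ring_of_type_algebra_def)
  have minus: "\<ominus>\<^bsub>?R\<^esub> x = - x" for x :: 'a
    by (rule R.minus_equality) (simp_all add: add zero carrier)
  \<comment> \<open>The inverse of \<open>x\<close> is \<open>x ^ (q - 2)\<close>, again the image
    of an integer.\<close>
  have "inv\<^bsub>?R\<^esub> x \<in> range of_int" if "x \<in> range of_int - {0}" for x :: 'a
  proof -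
    have "CARD('a) > 1" using card_mono[of "UNIV :: 'a set" "{0, 1}"] by simp
    hence "CARD('a) - 2 + 1 = CARD('a) - 1"
      by simp
    hence "[CARD('a) - 2 + 1 = 0] (mod (CARD('a) - 1))"
      by (simp only: cong_def mod_self mod_0)
    hence "x ^ (CARD('a) - 2) * x = 1"
      using finite_field_power_cong[of "CARD('a) - 2 + 1" 0 x] that by (simp add: mult.commute)
    hence "inv\<^bsub>?R\<^esub> x = x ^ (CARD('a) - 2)"
      by (intro R.comm_inv_char) (simp_all add: mult one carrier mult.commute)
    thus ?thesis
      using that by (auto simp flip: of_int_power)
  qed
  moreover have "subring (range of_int) ?R"
    by (rule R.subringI)
       (auto simp: add mult one minus carrier simp flip: of_int_add of_int_mult of_int_minus
          intro: range_eqI[of _ _ 1])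
  ultimately show ?thesis
    by (intro R.subfieldI') (simp_all add: zero)
qed

text \<open>Coordinates in a basis over the prime field; this ties the dimension in
  \<open>prime_degree\<close> to the cardinality.\<close>

lemma card_eq_CHAR_power: "CARD('a::finite_field) = CHAR('a) ^ prime_degree TYPE('a)"
proof -
  let ?R = "ring_of_type_algebra :: 'a ring" and ?K = "range of_int :: 'a set"
  interpret R: field ?R by rule
  have carrier: "carrier ?R = UNIV"
    by (simp add: ring_of_type_algebra_def)
  note K = subfield_prime_field[where ?'a = 'a]
  obtain Us :: "'a list" where "set Us = UNIV"
    using finite_list[of "UNIV :: 'a set"] by auto
  hence "R.Span ?K Us = UNIV"
    using R.Span_base_incl[OF K, of Us] carrier by auto
  hence "R.finite_dimension ?K UNIV"
    using R.Span_finite_dimension[OF K, of Us] carrier by simp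
  hence "R.dimension (prime_degree TYPE('a)) ?K UNIV"
    using R.finite_dimensionE[OF K] by (simp add: prime_degree_def over_def)
  then obtain Vs where Vs: "R.independent ?K Vs" "length Vs = prime_degree TYPE('a)"
      "R.Span ?K Vs = UNIV"
    using R.exists_base[OF K] by metis
  have unique: "\<exists>!Ks. set Ks \<subseteq> ?K \<and> length Ks = length Vs \<and> a = R.combine Ks Vs" for a
    using R.unique_decomposition[OF K Vs(1)] Vs(3) by blast
  have "bij_betw (\<lambda>Ks. R.combine Ks Vs) {Ks. set Ks \<subseteq> ?K \<and> length Ks = length Vs} UNIV"
    unfolding bij_betw_def inj_on_def using unique by blast
  from bij_betw_same_card[OF this] have "CARD('a) = card ?K ^ length Vs"
    by (simp add: card_lists_length_eq)
  thus ?thesis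
    by (simp add: card_prime_field Vs(2))
qed

lemma prime_degree_pos: "prime_degree TYPE('a::finite_field) > 0"
proof (rule Nat.gr0I)
  assume "prime_degree TYPE('a) = 0"
  hence "CARD('a) = 1" by (simp add: card_eq_CHAR_power)
  moreover have "card {0, 1 :: 'a} \<le> CARD('a)" by (intro card_mono) auto
  ultimately show False by simp
qed

lemma abs_trace_add: "abs_trace (x + y) = abs_trace x + abs_trace (y :: 'a::finite_field)"
  unfolding abs_trace_def sum.distrib[symmetric]
  by (intro sum.cong refl freshmans_dream') auto

text \<open>\<open>X^p - X\<close> has at most \<open>p\<close> roots, and the \<open>p\<close>
  elements of the prime field are roots.\<close>

lemma frobenius_fixed_imp_prime_field:
  fixes x :: "'a::finite_field"
  assumes "x ^ CHAR('a) = x"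
  shows "x \<in> range of_int"
proof -
  define f :: "'a poly" where "f = monom 1 CHAR('a) - monom 1 1"
  have p1: "CHAR('a) > 1" using prime_gt_1_nat[of "CHAR('a)"] by simp
  hence "coeff f CHAR('a) = 1" by (simp add: f_def)
  hence "f \<noteq> 0" by (metis coeff_0 zero_neq_one)
  have "degree f \<le> CHAR('a)"
    unfolding f_def using p1 by (intro degree_diff_le) (auto simp: degree_monom_eq)
  hence card: "card {x. poly f x = 0} \<le> CHAR('a)"
    using card_poly_roots_bound[OF \<open>f \<noteq> 0\<close>] by linarith
  have "(of_nat k :: 'a) ^ CHAR('a) = of_nat k" for k
    by (induction k) (simp_all add: freshmans_dream zero_power)
  hence "of_nat ` {..<CHAR('a)} \<subseteq> {x. poly f x = 0}"
    by (auto simp: f_def poly_monom)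
  hence "range of_int \<subseteq> {x. poly f x = 0}"
    using bij_betw_imp_surj_on[OF bij_betw_of_nat_prime_field[where ?'a = 'a]] by simp
  hence "range of_int = {x. poly f x = 0}"
    using card by (intro card_seteq) (simp_all add: card_prime_field)
  thus ?thesis using assms by (auto simp: f_def poly_monom)
qed

text \<open>Frobenius permutes the summands of the trace cyclically, since
  \<open>x ^ q = x\<close>.\<close>

lemma abs_trace_in_prime_field: "abs_trace (x :: 'a::finite_field) \<in> range of_int"
proof (rule frobenius_fixed_imp_prime_field)
  let ?n = "prime_degree TYPE('a)"
  have "abs_trace x ^ CHAR('a) = (\<Sum>i<?n. (x ^ (CHAR('a) ^ i)) ^ CHAR('a))"
    unfolding abs_trace_def by (intro freshmans_dream_sum) auto
  also have "\<dots> = (\<Sum>i<?n. x ^ (CHAR('a) ^ Suc i))"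
    by (simp add: mult.commute flip: power_mult)
  also have "\<dots> = (\<Sum>i<Suc ?n. x ^ (CHAR('a) ^ i)) - x"
    by (subst sum.lessThan_Suc_shift) simp
  also have "\<dots> = abs_trace x"
    using finite_field_power_card_eq_same[of x]
    by (simp add: abs_trace_def card_eq_CHAR_power[where ?'a = 'a])
  finally show "abs_trace x ^ CHAR('a) = abs_trace x" .
qed

text \<open>The trace is given by a nonzero polynomial of degree at most \<open>p ^ (n - 1)\<close>,
  too small for \<open>q\<close> roots.\<close>

lemma abs_trace_nontrivial: "\<exists>x :: 'a::finite_field. abs_trace x \<noteq> 0"
proof (rule ccontr)
  assume *: "\<not> (\<exists>x :: 'a. abs_trace x \<noteq> 0)"
  let ?n = "prime_degree TYPE('a)" and ?p = "CHAR('a)"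
  define f :: "'a poly" where "f = (\<Sum>i<?n. monom 1 (?p ^ i))"
  have p1: "?p > 1" using prime_gt_1_nat[of ?p] by simp
  have "coeff f 1 = (\<Sum>i<?n. if i = 0 then 1 else 0)"
    unfolding f_def coeff_sum using p1 by (intro sum.cong) auto
  hence "coeff f 1 = 1"
    using prime_degree_pos[where ?'a = 'a] by simp
  hence "f \<noteq> 0" by (metis coeff_0 zero_neq_one)
  have "{x. poly f x = 0} = UNIV"
    using * by (auto simp: f_def poly_sum poly_monom abs_trace_def)
  hence "CARD('a) \<le> degree f"
    using card_poly_roots_bound[OF \<open>f \<noteq> 0\<close>] by simp
  also have "degree f \<le> ?p ^ (?n - 1)"
    unfolding f_def using p1
    by (intro degree_sum_le) (auto simp: degree_monom_eq intro!: power_increasing)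
  also have "\<dots> < ?p ^ ?n"
    using p1 prime_degree_pos[where ?'a = 'a] by (intro power_strict_increasing) auto
  also have "\<dots> = CARD('a)"
    by (simp add: card_eq_CHAR_power)
  finally show False by simp
qed

section \<open>Additivity and orthogonality of the character\<close>

lemma zeta_power_cong:
  assumes "[j = k] (mod p)" "p > 0"
  shows "zeta p ^ j = zeta p ^ k"
proof -
  have "zeta p ^ m = zeta p ^ (m mod p)" for m
  proof -
    have "zeta p ^ m = zeta p ^ (p * (m div p) + m mod p)"
      by simp
    also have "\<dots> = zeta p ^ (m mod p)"
      by (simp only: power_add power_mult zeta_power_self[OF assms(2)] power_one mult_1)
    finally show ?thesis .
  qed
  thus ?thesis
    using assms(1) unfolding cong_def by metis
qed

text \<open>Any representative of the trace may replace the least one, as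
  \<open>zeta p ^ p = 1\<close>.\<close>

lemma canonical_char_eq_zeta_power:
  fixes x :: "'a::finite_field"
  assumes "of_nat k = abs_trace x"
  shows "canonical_char x = zeta CHAR('a) ^ k"
proof -
  define j where "j = (LEAST k. of_nat k = abs_trace x)"
  have "of_nat j = abs_trace x"
    unfolding j_def using assms by (rule LeastI)
  hence "[j = k] (mod CHAR('a))"
    using assms by (simp flip: of_nat_eq_iff_cong_CHAR[where ?'a = 'a])
  hence "zeta CHAR('a) ^ j = zeta CHAR('a) ^ k"
    by (rule zeta_power_cong) simp
  moreover have "canonical_char x = zeta CHAR('a) ^ j"
    by (simp add: canonical_char_def j_def zeta_def mult_ac flip: exp_of_nat_mult)
  ultimately show ?thesis by simp
qed

lemma abs_trace_eq_of_nat: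
  obtains k where "of_nat k = abs_trace (x :: 'a::finite_field)"
  using abs_trace_in_prime_field[of x]
    bij_betw_imp_surj_on[OF bij_betw_of_nat_prime_field[where ?'a = 'a]] by (metis imageE)

lemma canonical_char_add:
  "canonical_char (x + y) = canonical_char x * canonical_char (y :: 'a::finite_field)"
proof -
  obtain j k where "of_nat j = abs_trace x" "of_nat k = abs_trace y"
    using abs_trace_eq_of_nat by metis
  moreover from this have "of_nat (j + k) = abs_trace (x + y)"
    by (simp add: abs_trace_add)
  ultimately show ?thesis
    by (simp only: canonical_char_eq_zeta_power power_add)
qed

lemma canonical_char_0 [simp]: "canonical_char (0 :: 'a::finite_field) = 1"
  using canonical_char_eq_zeta_power[of 0 "0 :: 'a"] by (simp add: abs_trace_def zero_power)

lemma canonical_char_in_cyclotomic_ints: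
  "canonical_char (x :: 'a::finite_field) \<in> cyclotomic_ints CHAR('a)"
  using abs_trace_eq_of_nat[of x] canonical_char_eq_zeta_power[of _ x] 
  by (metis cyclotomic_ints_power cyclotomic_ints_zeta)

lemma canonical_char_nontrivial: "\<exists>x :: 'a::finite_field. canonical_char x \<noteq> 1"
proof -
  let ?p = "CHAR('a)"
  obtain x :: 'a where "abs_trace x \<noteq> 0"
    using abs_trace_nontrivial by blast
  moreover obtain k where k: "of_nat k = abs_trace x"
    using abs_trace_eq_of_nat by blast
  ultimately have "\<not> ?p dvd k"
    by (simp flip: of_nat_eq_0_iff_char_dvd)
  hence "coprime k ?p"
    using prime_imp_coprime[of ?p k] by (simp add: coprime_commute)
  then obtain e where "[k * e = 1] (mod ?p)"
    using cong_solve_coprime_nat by auto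
  hence "(zeta ?p ^ k) ^ e = zeta ?p"
    using zeta_power_cong[of "k * e" 1 ?p] by (simp add: power_mult)
  hence "zeta ?p ^ k \<noteq> 1"
    using zeta_neq_1[of ?p] prime_gt_1_nat[of ?p] by auto
  thus ?thesis
    using canonical_char_eq_zeta_power[OF k] by metis
qed

text \<open>Translating \<open>x\<close> by \<open>y / a\<close> multiplies the sum by
  \<open>canonical_char y\<close>, which is chosen different from 1.\<close>

lemma sum_canonical_char:
  "(\<Sum>x\<in>UNIV. canonical_char (a * x)) = (if a = 0 then of_nat CARD('a) else 0)"
  for a :: "'a::finite_field"
proof (cases "a = 0")
  case False
  obtain y :: 'a where y: "canonical_char y \<noteq> 1"
    using canonical_char_nontrivial by blast
  let ?S = "\<Sum>x\<in>UNIV. canonical_char (a * x)"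
  have "?S = (\<Sum>x\<in>UNIV. canonical_char (a * (x + y / a)))"
    by (rule sum.reindex_bij_witness[of _ "\<lambda>x. x + y / a" "\<lambda>x. x - y / a"]) auto
  also have "\<dots> = (\<Sum>x\<in>UNIV. canonical_char (a * x) * canonical_char y)"
    using False by (simp add: distrib_left canonical_char_add)
  also have "\<dots> = ?S * canonical_char y"
    by (simp add: sum_distrib_right)
  finally have "?S * (canonical_char y - 1) = 0"
    by (simp add: algebra_simps)
  thus ?thesis using y False by simp
qed simp

section \<open>The third moment of the Weil sums\<close>

lemma prod_sum3:
  fixes f g h :: "'a::finite \<Rightarrow> 'b::comm_semiring_1"
  shows "(\<Sum>x\<in>UNIV. f x) * (\<Sum>y\<in>UNIV. g y) * (\<Sum>z\<in>UNIV. h z) = (\<Sum>(x, y, z)\<in>UNIV. f x * g y * h z)"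
proof -
  have "(\<Sum>x\<in>UNIV. f x) * (\<Sum>y\<in>UNIV. g y) * c = (\<Sum>x\<in>UNIV. \<Sum>y\<in>UNIV. f x * g y * c)" for c
    by (subst sum_product) (simp only: sum_distrib_right)
  from this[of "\<Sum>z\<in>UNIV. h z"] show ?thesis
    unfolding sum_distrib_left[of "f _ * g _" h]
    by (simp only: UNIV_Times_UNIV[symmetric] sum.cartesian_product)
qed

text \<open>Double summation of the character of \<open>(r x + s y + t z) a\<close>: summing over
  triples first leaves \<open>q^3\<close> from \<open>a = 0\<close>, summing over \<open>a\<close>
  first gives \<open>q\<close> for each point of the plane.\<close>

lemma card_plane:
  fixes r s t :: "'a::finite_field"
  assumes "(r, s, t) \<noteq> (0, 0, 0)"
  shows "card {(x, y, z). r * x + s * y + t * z = 0} = CARD('a) ^ 2"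
proof -
  let ?q = "of_nat CARD('a) :: complex" and ?L = "{(x, y, z). r * x + s * y + t * z = 0}"
  have "(\<Sum>a\<in>UNIV. \<Sum>(x, y, z)\<in>UNIV. canonical_char ((r * x + s * y + t * z) * a)) =
      (\<Sum>a\<in>UNIV. \<Sum>(x, y, z)\<in>UNIV.
        canonical_char (r * a * x) * canonical_char (s * a * y) * canonical_char (t * a * z))"
    unfolding canonical_char_add[symmetric] by (simp only: distrib_right distrib_left mult_ac)
  also have "\<dots> = (\<Sum>a::'a\<in>UNIV. if a = 0 then ?q ^ 3 else 0)"
    unfolding prod_sum3[symmetric] sum_canonical_char
    by (intro sum.cong) (use assms in \<open>auto simp: power3_eq_cube\<close>)
  also have "\<dots> = ?q ^ 3" by simp
  finally have "?q ^ 3 = (\<Sum>(x, y, z)\<in>UNIV. \<Sum>a\<in>UNIV. canonical_char ((r * x + s * y + t * z) * a))"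
    by (subst (asm) sum.swap) (simp add: case_prod_unfold)
  also have "\<dots> = (\<Sum>v\<in>UNIV. if v \<in> ?L then ?q else 0)"
    by (intro sum.cong) (auto simp: sum_canonical_char)
  also have "\<dots> = ?q * of_nat (card ?L)"
    by (simp flip: sum.inter_filter)
  finally have "?q * ?q ^ 2 = ?q * of_nat (card ?L)"
    by (simp add: power3_eq_cube power2_eq_square)
  hence "of_nat (card ?L) = (of_nat (CARD('a) ^ 2) :: complex)"
    by simp
  thus ?thesis by (simp only: of_nat_eq_iff)
qed

lemma weil_sum_triple_product:
  fixes r s t a :: "'a::finite_field"
  shows "weil_sum d (r * a) * weil_sum d (s * a) * weil_sum d (t * a) =
    (\<Sum>(x, y, z)\<in>UNIV. canonical_char (x ^ d + y ^ d + z ^ d) *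
      canonical_char (- (r * x + s * y + t * z) * a))"
  unfolding weil_sum_def prod_sum3
  unfolding canonical_char_add[symmetric]
  by (intro sum.cong refl) (auto intro!: arg_cong[of _ _ canonical_char] simp: algebra_simps)

lemma weil_sum_third_moment:
  fixes r s t :: "'a::finite_field"
  defines "L \<equiv> {(x, y, z). r * x + s * y + t * z = 0}"
  assumes rst: "(r, s, t) \<noteq> (0, 0, 0)" and bij: "bij (\<lambda>x::'a. x ^ d)" and d: "d > 0"
  shows "(of_nat CARD('a) - 1) * (\<Sum>a\<in>UNIV. weil_sum d (r * a) * weil_sum d (s * a) * weil_sum d (t * a)) =
    of_nat CARD('a) ^ 2 *
      (of_nat (card {(x, y, z) \<in> L. x ^ d + y ^ d + z ^ d = 0}) - of_nat CARD('a))"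
proof -
  let ?q = "of_nat CARD('a) :: complex"
  define S :: "'a \<times> 'a \<times> 'a \<Rightarrow> 'a" where "S = (\<lambda>(x, y, z). x ^ d + y ^ d + z ^ d)"
  define T where "T = (\<Sum>v\<in>L. canonical_char (S v))"
  define M where "M = card {v \<in> L. S v = 0}"
  have moment: "(\<Sum>a\<in>UNIV. weil_sum d (r * a) * weil_sum d (s * a) * weil_sum d (t * a)) = ?q * T"
  proof -
    have "(\<Sum>a\<in>UNIV. weil_sum d (r * a) * weil_sum d (s * a) * weil_sum d (t * a)) =
      (\<Sum>v\<in>UNIV. \<Sum>a\<in>UNIV. canonical_char (S v) *
        (case v of (x, y, z) \<Rightarrow> canonical_char (- (r * x + s * y + t * z) * a)))"
      unfolding weil_sum_triple_product
      by (subst sum.swap) (simp add: S_def case_prod_unfold)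
    also have "\<dots> = (\<Sum>v\<in>UNIV. if v \<in> L then canonical_char (S v) * ?q else 0)"
    proof (intro sum.cong refl)
      fix v :: "'a \<times> 'a \<times> 'a"
      obtain x y z where v: "v = (x, y, z)" by (cases v)
      show "(\<Sum>a\<in>UNIV. canonical_char (S v) *
          (case v of (x, y, z) \<Rightarrow> canonical_char (- (r * x + s * y + t * z) * a))) =
        (if v \<in> L then canonical_char (S v) * ?q else 0)"
        unfolding v prod.case sum_distrib_left[symmetric] sum_canonical_char
        by (simp only: neg_equal_0_iff_equal L_def mem_Collect_eq prod.case) simp
    qed
    also have "\<dots> = ?q * T"
      by (simp add: T_def sum_distrib_left mult.commute flip: sum.inter_filter)
    finally show ?thesis .
  qed
  \<comment> \<open>Write \<open>m = c ^ d\<close>. The plane \<open>L\<close> is stable under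
    scaling by \<open>c\<close>, and scaling multiplies \<open>S\<close> by
    \<open>m\<close>.\<close>
  have scale: "(\<Sum>v\<in>L. canonical_char (S v * m)) = T" if "m \<noteq> 0" for m
  proof -
    obtain c where c: "m = c ^ d"
      using bij_is_surj[OF bij] by (metis surjD)
    hence c0: "c \<noteq> 0" using that d by auto
    show ?thesis unfolding T_def
    proof (rule sum.reindex_bij_witness[of _ "\<lambda>(x, y, z). (x / c, y / c, z / c)"
          "\<lambda>(x, y, z). (c * x, c * y, c * z)"])
      fix v assume "v \<in> L"
      thus "(case v of (x, y, z) \<Rightarrow> (c * x, c * y, c * z)) \<in> L"
        by (auto simp: L_def mult.left_commute[of _ c] simp flip: distrib_left)
    next
      fix v assume "v \<in> L"
      thus "(case v of (x, y, z) \<Rightarrow> (x / c, y / c, z / c)) \<in> L"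
        by (auto simp: L_def simp flip: add_divide_distrib)
    qed (use c0 in \<open>auto simp: S_def c power_mult_distrib algebra_simps\<close>)
  qed
  \<comment> \<open>Zeros of \<open>S\<close> on \<open>L\<close> are detected by summing over all
    \<open>m\<close>: \<open>m = 0\<close> contributes \<open>card L\<close>, each other
    \<open>m\<close> contributes \<open>T\<close>.\<close>
  have "?q * of_nat M = (\<Sum>v\<in>L. if S v = 0 then ?q else 0)"
    by (simp add: M_def mult.commute flip: sum.inter_filter)
  also have "\<dots> = (\<Sum>m\<in>UNIV. \<Sum>v\<in>L. canonical_char (S v * m))"
    by (subst sum.swap) (simp add: sum_canonical_char)
  also have "\<dots> = of_nat (card L) + (\<Sum>m\<in>UNIV - {0}. \<Sum>v\<in>L. canonical_char (S v * m))"
    by (subst sum.remove[of _ 0]) simp_all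
  also have "(\<Sum>m\<in>UNIV - {0}. \<Sum>v\<in>L. canonical_char (S v * m)) = (\<Sum>m\<in>UNIV - {0::'a}. T)"
    by (intro sum.cong refl scale) auto
  also have "\<dots> = (?q - 1) * T"
    by (simp add: card_Diff_subset of_nat_diff)
  also have "of_nat (card L) = ?q ^ 2"
    using card_plane[OF rst] by (simp add: L_def)
  finally have "(?q - 1) * T = ?q * (of_nat M - ?q)"
    by (simp add: algebra_simps power2_eq_square)
  hence "(?q - 1) * (?q * T) = ?q ^ 2 * (of_nat M - ?q)"
    by (simp add: power2_eq_square mult.left_commute)
  moreover have "{(x, y, z) \<in> L. x ^ d + y ^ d + z ^ d = 0} = {v \<in> L. S v = 0}"
    by (auto simp: S_def)
  ultimately show ?thesis
    unfolding moment M_def by simp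
qed

lemma weil_sum_in_cyclotomic_ints: "weil_sum d (a :: 'a::finite_field) \<in> cyclotomic_ints CHAR('a)"
  unfolding weil_sum_def by (intro cyclotomic_ints_sum canonical_char_in_cyclotomic_ints)

lemma weil_sums_divisible_imp_blocking:
  fixes r s t :: "'a::finite_field"
  assumes rst: "(r, s, t) \<noteq> (0, 0, 0)" and bij: "bij (\<lambda>x::'a. x ^ d)" and d: "d > 0"
    and val: "\<And>a :: 'a. ereal (2 / 3 * real (prime_degree TYPE('a))) < val_p CHAR('a) (weil_sum d a)"
  shows "\<exists>x y z. (x, y, z) \<noteq> (0, 0, 0) \<and> r * x + s * y + t * z = 0 \<and> x ^ d + y ^ d + z ^ d = 0"
proof (rule ccontr)
  let ?p = "CHAR('a)" and ?n = "prime_degree TYPE('a)"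
  define C where "C = {(x, y, z) \<in> {(x, y, z). r * x + s * y + t * z = 0}. x ^ d + y ^ d + z ^ d = 0}"
  assume "\<not> ?thesis"
  \<comment> \<open>With the origin as only zero, the third moment carries the factor
    \<open>1 - q\<close>, which is prime to \<open>p\<close>.\<close>
  hence "C = {(0, 0, 0)}"
    using d by (auto simp: C_def)
  hence C: "card C = 1" by simp
  have p: "prime ?p" by simp
  \<comment> \<open>The least integer exceeding \<open>2 n (p - 1) / 3\<close>; the valuation is
    measured in steps of \<open>1 / (p - 1)\<close>.\<close>
  define k where "k = 2 * ?n * (?p - 1) div 3 + 1"
  have "\<exists>w\<in>cyclotomic_ints ?p. weil_sum d a = (1 - zeta ?p) ^ k * w" for a :: 'a
  proof (rule less_val_p_imp_lambda_power_dvd[OF p weil_sum_in_cyclotomic_ints val])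
    fix m assume "2 / 3 * real ?n * (real ?p - 1) < real m"
    hence "real (2 * ?n * (?p - 1)) < real (3 * m)"
      using prime_gt_1_nat[OF p] by (simp add: of_nat_diff field_simps)
    hence "2 * ?n * (?p - 1) < 3 * m" by (simp only: of_nat_less_iff)
    thus "k \<le> m" by (simp add: k_def div_less_iff_less_mult Suc_le_eq mult.commute)
  qed
  then obtain w where w: "\<And>a :: 'a. w a \<in> cyclotomic_ints ?p"
      "\<And>a :: 'a. weil_sum d a = (1 - zeta ?p) ^ k * w a"
    by metis
  \<comment> \<open>The surplus of \<open>3 * k\<close> over \<open>2 n (p - 1) + 1\<close>; the
    choice of \<open>k\<close> keeps this subtraction from truncating.\<close>
  define e where "e = 3 * k - (2 * ?n * (?p - 1) + 1)"
  define A where "A = (\<Sum>a\<in>UNIV. w (r * a) * w (s * a) * w (t * a))"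
  have "k + k + k = 2 * ?n * (?p - 1) + 1 + e"
    unfolding e_def k_def by simp
  hence "(1 - zeta ?p) ^ k * (1 - zeta ?p) ^ k * (1 - zeta ?p) ^ k =
      (1 - zeta ?p) ^ (2 * ?n * (?p - 1) + 1) * (1 - zeta ?p) ^ e"
    by (simp only: power_add[symmetric])
  moreover have "(\<Sum>a\<in>UNIV. weil_sum d (r * a) * weil_sum d (s * a) * weil_sum d (t * a)) =
      (1 - zeta ?p) ^ k * (1 - zeta ?p) ^ k * (1 - zeta ?p) ^ k * A"
    unfolding A_def w(2) by (simp add: sum_distrib_left mult_ac)
  ultimately have "(of_nat CARD('a) - 1) *
      ((1 - zeta ?p) ^ (2 * ?n * (?p - 1) + 1) * (1 - zeta ?p) ^ e * A) =
      of_nat CARD('a) ^ 2 * (1 - of_nat CARD('a))"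
    using weil_sum_third_moment[OF rst bij d] C by (simp add: C_def)
  also have "\<dots> = of_nat ?p ^ (2 * ?n) * of_int (1 - int CARD('a))"
    by (simp add: card_eq_CHAR_power[where ?'a = 'a] mult.commute flip: power_mult)
  finally have eq: "of_nat ?p ^ (2 * ?n) * of_int (1 - int CARD('a)) =
      (1 - zeta ?p) ^ (2 * ?n * (?p - 1) + 1) * ((of_nat CARD('a) - 1) * ((1 - zeta ?p) ^ e * A))"
    by (simp only: mult_ac)
  have "A \<in> cyclotomic_ints ?p"
    unfolding A_def by (intro cyclotomic_ints_sum cyclotomic_ints_mult w)
  hence "int ?p dvd 1 - int CARD('a)"
    by (intro lambda_power_dvd_imp_dvd[OF p _ eq]) simp
  moreover have "int ?p dvd int CARD('a)"
    using prime_degree_pos[where ?'a = 'a] by (simp add: card_eq_CHAR_power[where ?'a = 'a])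
  ultimately have "int ?p dvd (1 - int CARD('a)) + int CARD('a)"
    by (rule dvd_add)
  thus False using prime_gt_1_nat[OF p] by simp
qed

theorem theorem3p1:
  fixes d :: nat
  assumes "d > 0"
    and "gcd d (CARD('a::finite_field) - 1) = 1"
    and "\<not> degenerate TYPE('a) d"
  shows "weil_min_val TYPE('a) d \<le> ereal (2 / 3 * real (prime_degree TYPE('a)))"
proof (rule ccontr)
  let ?W = "range (\<lambda>a :: 'a. val_p CHAR('a) (weil_sum d a))"
  assume "\<not> ?thesis"
  hence "ereal (2 / 3 * real (prime_degree TYPE('a))) < Min ?W"
    unfolding weil_min_val_def not_le .
  moreover have "Min ?W \<le> val_p CHAR('a) (weil_sum d a)" for a :: 'a
    by (rule Min_le) auto
  ultimately have val: "ereal (2 / 3 * real (prime_degree TYPE('a))) < val_p CHAR('a) (weil_sum d a)"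
    for a :: 'a
    by (rule less_le_trans)
  have bij: "bij (\<lambda>x::'a. x ^ d)"
    by (rule bij_power_coprime[OF assms(1,2)])
  have line: "u ^ d + (1 - u) ^ d = 1" for u :: 'a
    by (rule blocking_imp_power_one_minus[OF bij assms(1)])
       (rule weil_sums_divisible_imp_blocking[OF _ bij assms(1) val])
  \<comment> \<open>Put \<open>u = - x\<close> in \<open>line\<close>.\<close>
  have "(1 + x) ^ d = 1 + x ^ d" for x :: 'a
  proof -
    have "(- x) ^ d = - (x ^ d)"
      using minus_one_power_of_inj[OF bij_is_inj[OF bij]]
      by (metis mult_minus1 power_mult_distrib)
    thus ?thesis using line[of "- x"] by (simp add: algebra_simps)
  qed
  from power_one_plus_imp_degenerate[OF assms(1,2) this] show False
    using assms(3) by simp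
qed

end
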